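(* There exists a set $\mathscr{V}_0 \subset \left[-\tfrac12,\tfrac12\right]\times\left[-\tfrac12,\tfrac12\right]\times[0,1] \subset \mathbb{R}^3$, together with a family of surfaces $\{\Sigma_s\}_{s\in[0,1)}$, such that the following holds. (1) $\mathscr{V}_0$ is a smooth convex body that is rotationally symmetric with respect to the $z$-axis. (2) $\overline{\mathscr{V}_0} = \bigcup_{s\in[0,1)}\Sigma_s$, where each $\Sigma_s$ is a smooth convex surface. Also, $\Sigma_s\cap\Sigma_{s'} = \{\mathbf{0}\}$ and $T_{\mathbf{0}}\Sigma_s = T_{\mathbf{0}}\Sigma_{s'} = \partial\mathbb{R}^3_+$ for any $s\ne s'$ in $[0,1)$. (3) There is a smooth function $z_0 : [0,1]\to\left[0,\tfrac14\right]$, with $z_0(s)$ decreasing to $0$ as $s$ increases to $1$, such that for each $s\in[0,1)$ the set $\Sigma_s\cap\{0\le z\le z_0(s)\}$ is a paraboloid and the set $\Sigma_s\cap\{4z_0(s)\le z\le 1\}$ is a spherical cap. (4) There exists a universal constant $c_0>0$ such that the volume of $\bigcup_{s\in\left(\frac14,\frac12\right)}\Sigma_s$ is at least $c_0$.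
   Context: Points of $\mathbb{R}^3$ have coordinates $(x,y,z)$, with $z$ the third coordinate. $\mathbb{R}^3_+$ is the upper half-space $\{z>0\}$, $\partial\mathbb{R}^3_+ = \{z=0\}$ is its boundary plane, and $\mathbf{0}$ is the origin of $\mathbb{R}^3$. $T_{\mathbf{0}}\Sigma_s$ is the tangent plane of $\Sigma_s$ at $\mathbf{0}$. "Paraboloid" and "spherical cap" refer to the corresponding pieces of surfaces (a portion of a paraboloid, respectively of a sphere). *)

theory Defs
  imports "HOL-Analysis.Analysis"
begin

text \<open>
  \<open>Ck_on k U f\<close> is meant for open \<open>U\<close>: all iterated directional derivatives of \<open>f\<close> up to
  order \<open>k\<close> exist (as values of Frechet derivatives) and are continuous on \<open>U\<close>.
\<close>

primrec Ck_on :: "nat \<Rightarrow> 'a set \<Rightarrow> ('a::euclidean_space \<Rightarrow> 'b::real_normed_vector) \<Rightarrow> bool" where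
  "Ck_on 0 U f \<longleftrightarrow> continuous_on U f"
| "Ck_on (Suc k) U f \<longleftrightarrow>
     (\<forall>x\<in>U. f differentiable (at x)) \<and>
     (\<forall>v. Ck_on k U (\<lambda>x. frechet_derivative f (at x) v))"

text \<open>
  On a set that need not be open, smoothness means having a smooth extension to an open
  neighbourhood; for open \<open>S\<close> this is ordinary smoothness.
\<close>

definition smooth_on :: "'a set \<Rightarrow> ('a::euclidean_space \<Rightarrow> 'b::real_normed_vector) \<Rightarrow> bool" where
  "smooth_on S f \<longleftrightarrow>
     (\<exists>U g. open U \<and> S \<subseteq> U \<and> (\<forall>k. Ck_on k U g) \<and> (\<forall>x\<in>S. g x = f x))"

text \<open>Regular surfaces in space, given by local parametrizations.\<close>

definition smooth_surface :: "(real^3) set \<Rightarrow> bool" where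
  "smooth_surface S \<longleftrightarrow>
     (\<forall>p\<in>S. \<exists>(U :: (real^2) set) V X Y.
        open U \<and> open V \<and> p \<in> V \<and> smooth_on U X \<and> homeomorphism U (S \<inter> V) X Y \<and>
        (\<forall>u\<in>U. inj (frechet_derivative X (at u))))"

text \<open>The tangent plane is the affine plane through \<open>p\<close>, spanned by velocities of curves in \<open>S\<close>.\<close>

definition tangent_plane :: "(real^3) set \<Rightarrow> real^3 \<Rightarrow> (real^3) set" where
  "tangent_plane S p =
     {p + v | v. \<exists>\<gamma> e. 0 < e \<and> smooth_on {-e<..<e} \<gamma> \<and> \<gamma> ` {-e<..<e} \<subseteq> S \<and> \<gamma> 0 = p \<and>
                       (\<gamma> has_vector_derivative v) (at (0::real))}"

definition convex_body :: "(real^3) set \<Rightarrow> bool" where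
  "convex_body K \<longleftrightarrow> compact K \<and> convex K \<and> interior K \<noteq> {}"

definition smooth_convex_body :: "(real^3) set \<Rightarrow> bool" where
  "smooth_convex_body K \<longleftrightarrow> convex_body K \<and> smooth_surface (frontier K)"

definition smooth_convex_surface :: "(real^3) set \<Rightarrow> bool" where
  "smooth_convex_surface S \<longleftrightarrow> smooth_surface S \<and> (\<exists>K. convex_body K \<and> S = frontier K)"

definition rotation_z :: "real \<Rightarrow> real^3 \<Rightarrow> real^3" where
  "rotation_z \<theta> p =
     vector [cos \<theta> * p$1 - sin \<theta> * p$2, sin \<theta> * p$1 + cos \<theta> * p$2, p$3]"

definition rotationally_symmetric_z :: "(real^3) set \<Rightarrow> bool" where
  "rotationally_symmetric_z A \<longleftrightarrow> (\<forall>\<theta>. rotation_z \<theta> ` A = A)"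

text \<open>
  The full (elliptic) paraboloid, up to a rigid motion. Hyperbolic paraboloids are left out, as
  they do not occur as pieces of convex surfaces.
\<close>

definition paraboloid :: "(real^3) set \<Rightarrow> bool" where
  "paraboloid P \<longleftrightarrow>
     (\<exists>a b c T. 0 < a \<and> 0 < b \<and> orthogonal_transformation T \<and>
        P = (\<lambda>q. c + T q) ` {q :: real^3. q$3 = a * (q$1)\<^sup>2 + b * (q$2)\<^sup>2})"

text \<open>The bound on \<open>d\<close> says that the cutting plane crosses the sphere, and is not tangent to it.\<close>

definition spherical_cap :: "(real^3) set \<Rightarrow> bool" where
  "spherical_cap A \<longleftrightarrow>
     (\<exists>c r n d. 0 < r \<and> norm n = 1 \<and> \<bar>d - n \<bullet> c\<bar> < r \<and> A = sphere c r \<inter> {q. d \<le> n \<bullet> q})"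

definition halfspace_boundary :: "(real^3) set" where
  "halfspace_boundary = {p. p$3 = 0}"

definition slab :: "real \<Rightarrow> real \<Rightarrow> (real^3) set" where
  "slab h1 h2 = {p. h1 \<le> p$3 \<and> p$3 \<le> h2}"

end

theory Submission
  imports Defs
begin

text \<open>
  The family is homothetic: \<open>\<Sigma>\<^sub>s = (1 - s) \<Sigma>\<^sub>0\<close>. Let \<open>\<V>\<close> be a smooth convex body that touches its supporting
  plane \<open>z = 0\<close> at the origin only. Since the boundary is smooth there, a ray from the origin into
  \<open>z > 0\<close> enters the interior of \<open>\<V>\<close> and leaves it exactly once, so the homothetic copies of
  \<open>\<Sigma>\<^sub>0 = \<partial>\<V>\<close> with ratios in \<open>(0,1]\<close> fill \<open>\<V>\<close> and meet only at the origin. A homothety preserves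
  smoothness, convexity, the tangent plane at the origin, paraboloids and spherical caps, and it
  multiplies the heights at which these pieces end by \<open>1 - s\<close>; so \<open>z\<^sub>0\<close> is a linear function.
  The part of \<open>\<V>\<close> swept out by ratios in an open interval contains a nonempty open set, hence has
  positive volume.

  It remains to find one body. Take \<open>\<V> = {x\<^sup>2 + y\<^sup>2 \<le> F z}\<close> with \<open>F\<close> smooth and concave on the
  whole line; it is convex, being a superlevel set of a concave function. A paraboloid of
  revolution corresponds to \<open>F z = a z\<close>, a sphere to \<open>F z = R\<^sup>2 - (z - c)\<^sup>2\<close>, and these have second
  derivatives \<open>0\<close> and \<open>- 2\<close>. In this description gluing the two costs nothing: let \<open>F'' = - 2 h\<close>
  with a smooth step \<open>h\<close> from \<open>0\<close> to \<open>1\<close>, and integrate twice. Concavity is automatic, and the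
  integration constants only decide which sphere appears (\<open>cap_profile_exists\<close>).

  The surface \<open>x\<^sup>2 + y\<^sup>2 = F z\<close> is a union of graphs: over the plane \<open>z = 0\<close> near its two points on
  the axis, where \<open>F\<close> is explicitly invertible, and over \<open>x = 0\<close> or \<open>y = 0\<close> elsewhere. So the
  regular level set theorem is replaced by explicit charts (\<open>graph_chart\<close>), whose smoothness
  follows from the chain rule and the smoothness of the square root on positive numbers.
\<close>

section \<open>Calculus of \<open>C\<^sup>k\<close> maps\<close>

lemma Ck_on_cong:
  assumes "open U" "Ck_on k U f" "\<And>x. x \<in> U \<Longrightarrow> f x = g x"
  shows "Ck_on k U g"
  using assms(2,3)
proof (induction k arbitrary: f g)
  case 0
  then show ?case by (simp cong: continuous_on_cong)
next
  case (Suc k)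
  have diff: "f differentiable at x" if "x \<in> U" for x
    using Suc.prems that by simp
  have "g differentiable at x" if "x \<in> U" for x
    using has_derivative_transform_within_open[of f _ x UNIV U g] diff[OF that] assms(1) that Suc.prems(2)
    unfolding differentiable_def by blast
  moreover have "Ck_on k U (\<lambda>x. frechet_derivative g (at x) v)" for v
  proof (rule Suc.IH)
    show "Ck_on k U (\<lambda>x. frechet_derivative f (at x) v)"
      using Suc.prems by simp
    show "frechet_derivative f (at x) v = frechet_derivative g (at x) v" if "x \<in> U" for x
      using frechet_derivative_transform_within_open[OF diff[OF that] assms(1) that] Suc.prems(2)
      by simp
  qed
  ultimately show ?case by simp
qed

text \<open>The derivative may be any function \<open>D\<close> known on \<open>U\<close> only; openness of \<open>U\<close> makes the choice
  outside \<open>U\<close> irrelevant to all further derivatives.\<close>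

lemma Ck_on_SucI:
  assumes "open U" "\<And>x. x \<in> U \<Longrightarrow> (f has_derivative D x) (at x)"
    and "\<And>v. Ck_on k U (\<lambda>x. D x v)"
  shows "Ck_on (Suc k) U f"
proof -
  have "Ck_on k U (\<lambda>x. frechet_derivative f (at x) v)" for v
    by (rule Ck_on_cong[OF assms(1) assms(3)[of v]])
      (use frechet_derivative_at[OF assms(2)] in metis)
  with assms(2) show ?thesis
    by (auto simp: differentiable_def)
qed

lemma Ck_on_has_derivative:
  assumes "Ck_on (Suc k) U f" "x \<in> U"
  shows "(f has_derivative frechet_derivative f (at x)) (at x)"
  using assms frechet_derivative_works by auto

lemma Ck_on_SucD: "Ck_on (Suc k) U f \<Longrightarrow> Ck_on k U f"
proof (induction k arbitrary: f)
  case 0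
  then show ?case
    by (auto intro!: continuous_at_imp_continuous_on differentiable_imp_continuous_within)
next
  case (Suc k)
  then show ?case by (metis Ck_on.simps(2))
qed

named_theorems Ck_intros

lemma Ck_on_const [Ck_intros]: "open U \<Longrightarrow> Ck_on k U (\<lambda>x. c)"
proof (induction k arbitrary: c)
  case (Suc k)
  show ?case
    by (rule Ck_on_SucI[where D = "\<lambda>x v. 0"]) (use Suc in auto)
qed auto

lemma Ck_on_bounded_linear_compose:
  assumes "bounded_linear L" "open U" "Ck_on k U f"
  shows "Ck_on k U (\<lambda>x. L (f x))"
  using assms(3)
proof (induction k arbitrary: f)
  case 0
  then show ?case
    by (simp add: assms(1) bounded_linear.continuous_on)
next
  case (Suc k)
  show ?case
  proof (rule Ck_on_SucI[OF assms(2)])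
    show "((\<lambda>x. L (f x)) has_derivative (\<lambda>v. L (frechet_derivative f (at x) v))) (at x)"
      if "x \<in> U" for x
      using bounded_linear.has_derivative[OF assms(1) Ck_on_has_derivative[OF Suc.prems that]] .
    show "Ck_on k U (\<lambda>x. L (frechet_derivative f (at x) v))" for v
      using Suc by auto
  qed
qed

lemma Ck_on_id: "open U \<Longrightarrow> Ck_on k U (\<lambda>x. x)"
proof (cases k)
  case (Suc j)
  assume "open U"
  then show ?thesis
    unfolding Suc by (intro Ck_on_SucI[where D = "\<lambda>x v. v"] Ck_on_const) auto
qed auto

lemma Ck_on_bounded_linear: "bounded_linear L \<Longrightarrow> open U \<Longrightarrow> Ck_on k U L"
  by (rule Ck_on_bounded_linear_compose[OF _ _ Ck_on_id])

lemma Ck_on_scaleR_const [Ck_intros]: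
  "open U \<Longrightarrow> Ck_on k U f \<Longrightarrow> Ck_on k U (\<lambda>x. f x *\<^sub>R c)"
  by (rule Ck_on_bounded_linear_compose[OF bounded_linear_scaleR_left])

lemma Ck_on_uminus [Ck_intros]: "open U \<Longrightarrow> Ck_on k U f \<Longrightarrow> Ck_on k U (\<lambda>x. - f x)"
  by (rule Ck_on_bounded_linear_compose[OF bounded_linear_minus[OF bounded_linear_ident]])

lemma Ck_on_add [Ck_intros]:
  assumes "open U" "Ck_on k U f" "Ck_on k U g"
  shows "Ck_on k U (\<lambda>x. f x + g x)"
  using assms(2,3)
proof (induction k arbitrary: f g)
  case 0
  then show ?case by (simp add: continuous_on_add)
next
  case (Suc k)
  show ?case
    by (rule Ck_on_SucI[OF assms(1) has_derivative_add[OF Ck_on_has_derivative[OF Suc.prems(1)]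
            Ck_on_has_derivative[OF Suc.prems(2)]]])
      (use Suc in auto)
qed

lemma Ck_on_diff [Ck_intros]:
  assumes "open U" "Ck_on k U f" "Ck_on k U g"
  shows "Ck_on k U (\<lambda>x. f x - g x)"
  using Ck_on_add[OF assms(1,2) Ck_on_uminus[OF assms(1,3)]] by simp

lemma Ck_on_mult [Ck_intros]:
  fixes f g :: "'a::euclidean_space \<Rightarrow> real"
  assumes "open U" "Ck_on k U f" "Ck_on k U g"
  shows "Ck_on k U (\<lambda>x. f x * g x)"
  using assms(2,3)
proof (induction k arbitrary: f g)
  case 0
  then show ?case by (simp add: continuous_on_mult)
next
  case (Suc k)
  show ?case
  proof (rule Ck_on_SucI[OF assms(1) has_derivative_mult[OF Ck_on_has_derivative[OF Suc.prems(1)]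
            Ck_on_has_derivative[OF Suc.prems(2)]]])
    show "Ck_on k U (\<lambda>x. f x * frechet_derivative g (at x) v + frechet_derivative f (at x) v * g x)"
      for v
      using Suc.prems Ck_on_SucD[OF Suc.prems(1)] Ck_on_SucD[OF Suc.prems(2)]
      by (intro Ck_on_add assms(1) Suc.IH) auto
  qed auto
qed

lemma Ck_on_power [Ck_intros]:
  fixes f :: "'a::euclidean_space \<Rightarrow> real"
  shows "open U \<Longrightarrow> Ck_on k U f \<Longrightarrow> Ck_on k U (\<lambda>x. f x ^ n)"
  by (induction n) (auto intro: Ck_intros)

text \<open>The derivative of a composite is a product of a composite with the smooth function \<open>g'\<close>
  and a derivative of \<open>f\<close>; as \<open>g'\<close> is again smooth, induction on \<open>k\<close> applies to it.\<close>

lemma Ck_on_compose: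
  fixes f :: "'a::euclidean_space \<Rightarrow> real" and g :: "real \<Rightarrow> real"
  assumes "open U" "\<And>j. Ck_on j V g" "Ck_on k U f" "f ` U \<subseteq> V"
  shows "Ck_on k U (\<lambda>x. g (f x))"
  using assms(2,3,4)
proof (induction k arbitrary: g)
  case 0
  from 0(1)[of 0] 0(2,3) show ?case
    using continuous_on_compose2[of V g U f] by simp
next
  case (Suc k)
  show ?case
  proof (rule Ck_on_SucI[OF assms(1)])
    fix x assume x: "x \<in> U"
    have g: "(g has_derivative frechet_derivative g (at (f x))) (at (f x))"
      by (rule Ck_on_has_derivative[OF Suc.prems(1)]) (use x Suc.prems(3) in auto)
    have "((\<lambda>x. g (f x)) has_derivative
        (\<lambda>v. frechet_derivative g (at (f x)) (frechet_derivative f (at x) v))) (at x)"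
      using has_derivative_compose[OF Ck_on_has_derivative[OF Suc.prems(2) x] g] .
    moreover have "(\<lambda>v. frechet_derivative g (at (f x)) (frechet_derivative f (at x) v)) =
        (\<lambda>v. frechet_derivative f (at x) v * frechet_derivative g (at (f x)) 1)" (is "?l = ?r")
    proof
      show "?l v = ?r v" for v
        using linear_cmul[OF has_derivative_linear[OF g], of "frechet_derivative f (at x) v" 1]
        by simp
    qed
    ultimately show "((\<lambda>x. g (f x)) has_derivative
        (\<lambda>v. frechet_derivative f (at x) v * frechet_derivative g (at (f x)) 1)) (at x)"
      by (rule has_derivative_eq_rhs)
  next
    fix v
    show "Ck_on k U (\<lambda>x. frechet_derivative f (at x) v * frechet_derivative g (at (f x)) 1)"
    proof (rule Ck_on_mult[OF assms(1)])
      show "Ck_on k U (\<lambda>x. frechet_derivative f (at x) v)" using Suc.prems(2) by simp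
      show "Ck_on k U (\<lambda>x. frechet_derivative g (at (f x)) 1)"
      proof (rule Suc.IH)
        show "Ck_on j V (\<lambda>y. frechet_derivative g (at y) 1)" for j
          using Suc.prems(1)[of "Suc j"] by simp
        show "Ck_on k U f" using Suc.prems(2) by (rule Ck_on_SucD)
      qed (rule Suc.prems(3))
    qed
  qed
qed

lemma Ck_on_compose_UNIV:
  fixes f :: "'a::euclidean_space \<Rightarrow> real" and g :: "real \<Rightarrow> real"
  assumes "open U" "\<And>j. Ck_on j UNIV g" "Ck_on k U f"
  shows "Ck_on k U (\<lambda>x. g (f x))"
  using Ck_on_compose[OF assms] by simp

lemma Ck_on_Suc_real:
  fixes f :: "real \<Rightarrow> real"
  assumes "open U" "\<And>x. x \<in> U \<Longrightarrow> (f has_real_derivative f' x) (at x)" "Ck_on k U f'"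
  shows "Ck_on (Suc k) U f"
  by (rule Ck_on_SucI[OF assms(1) assms(2)[unfolded has_field_derivative_def]])
    (assumption, rule Ck_on_mult[OF assms(1,3) Ck_on_const[OF assms(1)]])

lemma Ck_on_antiderivative:
  fixes f :: "real \<Rightarrow> real"
  assumes "\<And>x. (f has_real_derivative f' x) (at x)" "\<And>j. Ck_on j UNIV f'"
  shows "Ck_on k UNIV f"
  by (rule Ck_on_SucD[OF Ck_on_Suc_real[OF open_UNIV assms(1)]]) (rule assms(2))

lemma Ck_on_powr_const: "Ck_on k {0<..} (\<lambda>x::real. x powr r)"
proof (induction k arbitrary: r)
  case (Suc k)
  show ?case
  proof (rule Ck_on_Suc_real)
    show "((\<lambda>x. x powr r) has_real_derivative r * x powr (r - 1)) (at x)" if "x \<in> {0<..}" for x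
      using that by (auto intro: has_real_derivative_powr)
    show "Ck_on k {0<..} (\<lambda>x. r * x powr (r - 1))"
      by (intro Ck_intros Suc) auto
  qed auto
qed (auto intro!: continuous_intros)

lemma Ck_on_sqrt [Ck_intros]:
  assumes "open U" "Ck_on k U f" "\<And>x. x \<in> U \<Longrightarrow> 0 < f x"
  shows "Ck_on k U (\<lambda>x. sqrt (f x))"
proof (rule Ck_on_cong[OF assms(1)])
  show "Ck_on k U (\<lambda>x. f x powr (1/2))"
    by (rule Ck_on_compose[OF assms(1) Ck_on_powr_const assms(2)]) (use assms(3) in auto)
qed (use assms(3) in \<open>auto simp: powr_half_sqrt less_imp_le\<close>)

lemma Ck_on_inverse [Ck_intros]:
  assumes "open U" "Ck_on k U f" "\<And>x. x \<in> U \<Longrightarrow> 0 < f x"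
  shows "Ck_on k U (\<lambda>x. inverse (f x :: real))"
proof (rule Ck_on_cong[OF assms(1)])
  show "Ck_on k U (\<lambda>x. f x powr (- 1))"
    by (rule Ck_on_compose[OF assms(1) Ck_on_powr_const assms(2)]) (use assms(3) in auto)
qed (use assms(3) in \<open>auto simp: powr_minus less_imp_le\<close>)

lemma smooth_onI: "open U \<Longrightarrow> (\<And>k. Ck_on k U f) \<Longrightarrow> smooth_on U f"
  unfolding smooth_on_def by blast

lemma smooth_on_subset: "smooth_on S f \<Longrightarrow> T \<subseteq> S \<Longrightarrow> smooth_on T f"
  unfolding smooth_on_def by (meson subsetD subset_trans)

lemma smooth_on_UNIV_D: "smooth_on UNIV f \<Longrightarrow> Ck_on k UNIV f"
  unfolding smooth_on_def by (auto simp: top.extremum_unique intro: Ck_on_cong)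

section \<open>A smooth step\<close>

text \<open>The classical function \<open>exp (- 1 / x)\<close>, extended by zero, together with its multiples by powers
  of \<open>1 / x\<close>. The family is closed under differentiation up to linear combinations, which is what
  makes the proof of smoothness an induction.\<close>

definition flat_exp :: "nat \<Rightarrow> real \<Rightarrow> real" where
  "flat_exp n x = (if x \<le> 0 then 0 else exp (- inverse x) * inverse x ^ n)"

lemma flat_exp_nonneg: "0 \<le> flat_exp n x"
  by (simp add: flat_exp_def)

lemma flat_exp_pos: "0 < x \<Longrightarrow> 0 < flat_exp n x"
  by (simp add: flat_exp_def)

text \<open>A single term of the exponential series at \<open>1 / x\<close> gives quadratic decay at \<open>0\<close>, enough for
  the derivative at \<open>0\<close> to exist and vanish.\<close>

lemma flat_exp_le: "flat_exp n x \<le> fact (n + 2) * x\<^sup>2"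
proof (cases "x \<le> 0")
  case False
  define y where "y = inverse x"
  have "y ^ (n + 2) / fact (n + 2) \<le> exp y"
  proof -
    have "(\<Sum>k\<in>{n+2}. y ^ k /\<^sub>R fact k) \<le> (\<Sum>k. y ^ k /\<^sub>R fact k)"
      by (rule sum_le_suminf) (use False summable_exp_generic[of y] in \<open>auto simp: y_def\<close>)
    then show ?thesis by (simp add: exp_def divide_inverse_commute)
  qed
  then have "y ^ n * exp (- y) \<le> fact (n + 2) * x\<^sup>2"
    using False by (simp add: y_def exp_minus divide_simps power_add power2_eq_square) (simp add: algebra_simps)
  then show ?thesis
    using False by (simp add: flat_exp_def y_def mult.commute)
qed (simp add: flat_exp_def)

lemma flat_exp_has_derivative:
  "(flat_exp n has_real_derivative flat_exp (n + 2) x - n * flat_exp (n + 1) x) (at x)"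
proof -
  consider "x < 0" | "x = 0" | "x > 0" by linarith
  then show ?thesis
  proof cases
    case 1
    have "((\<lambda>x. 0) has_real_derivative 0) (at x)" by simp
    then have "(flat_exp n has_real_derivative 0) (at x)"
      by (rule has_field_derivative_transform_within_open[where S = "{..<0}"])
        (use 1 in \<open>auto simp: flat_exp_def\<close>)
    with 1 show ?thesis by (simp add: flat_exp_def)
  next
    case 2
    have "((\<lambda>y. flat_exp n y / y) \<longlongrightarrow> 0) (at 0)"
    proof (rule Lim_null_comparison)
      have "\<bar>flat_exp n y / y\<bar> \<le> fact (n + 2) * \<bar>y\<bar>" for y
        using flat_exp_le[of n y] flat_exp_nonneg[of n y]
        by (cases "y = 0") (auto simp: abs_divide divide_simps power2_eq_square abs_mult_self_eq mult.assoc)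
      then show "\<forall>\<^sub>F y in at 0. norm (flat_exp n y / y) \<le> fact (n + 2) * \<bar>y\<bar>"
        by simp
      show "((\<lambda>y. fact (n + 2) * \<bar>y\<bar>) \<longlongrightarrow> (0::real)) (at 0)"
        by (auto intro!: tendsto_eq_intros)
    qed
    with 2 show ?thesis
      by (simp add: has_field_derivative_iff flat_exp_def)
  next
    case 3
    have "((\<lambda>x. exp (- inverse x) * inverse x ^ n) has_real_derivative
        exp (- inverse x) * inverse x ^ (n + 2) -
        exp (- inverse x) * (n * inverse x ^ (n - 1) * inverse x ^ 2)) (at x)"
      using 3 by (auto intro!: derivative_eq_intros simp: power2_eq_square algebra_simps)
    moreover have "n * inverse x ^ (n - 1) * inverse x ^ 2 = n * inverse x ^ (n + 1)"
      by (cases n) (auto simp: power2_eq_square)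
    ultimately have "((\<lambda>x. exp (- inverse x) * inverse x ^ n) has_real_derivative
        exp (- inverse x) * inverse x ^ (n + 2) -
        exp (- inverse x) * (n * inverse x ^ (n + 1))) (at x)"
      by (simp only:)
    then have "((\<lambda>x. exp (- inverse x) * inverse x ^ n) has_real_derivative
        flat_exp (n + 2) x - n * flat_exp (n + 1) x) (at x)"
      using 3 by (simp add: flat_exp_def algebra_simps)
    then show ?thesis
      by (rule has_field_derivative_transform_within_open[where S = "{0<..}"])
        (use 3 in \<open>auto simp: flat_exp_def\<close>)
  qed
qed

lemma Ck_on_flat_exp: "Ck_on k UNIV (flat_exp n)"
proof (induction k arbitrary: n)
  case 0
  show ?case
    using flat_exp_has_derivative[of n]
    by (simp add: continuous_on_eq_continuous_at) (metis DERIV_isCont)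
next
  case (Suc k)
  show ?case
    by (rule Ck_on_Suc_real[OF _ flat_exp_has_derivative]) (auto intro!: Ck_intros Suc)
qed

text \<open>Normalizing the flat functions of \<open>x - a\<close> and \<open>b - x\<close> by their sum works because the two never
  vanish together when \<open>a < b\<close>.\<close>

lemma smooth_step_exists:
  fixes a b :: real
  assumes "a < b"
  obtains h where "\<And>k. Ck_on k UNIV h" "\<And>x. 0 \<le> h x" "\<And>x. h x \<le> 1"
    "\<And>x. x \<le> a \<Longrightarrow> h x = 0" "\<And>x. b \<le> x \<Longrightarrow> h x = (1::real)"
proof
  let ?e = "flat_exp 0"
  let ?h = "\<lambda>x. ?e (x - a) * inverse (?e (x - a) + ?e (b - x))"
  have pos: "0 < ?e (x - a) + ?e (b - x)" for x
    using flat_exp_pos[of "x - a" 0] flat_exp_pos[of "b - x" 0] flat_exp_nonneg[of 0 "x - a"]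
      flat_exp_nonneg[of 0 "b - x"] assms
    by (cases "a < x") (auto intro: add_pos_nonneg add_nonneg_pos)
  show "Ck_on k UNIV ?h" for k
    by (intro Ck_intros Ck_on_compose_UNIV[OF _ Ck_on_flat_exp] Ck_on_id open_UNIV pos)
  show "0 \<le> ?h x" for x
    using flat_exp_nonneg[of 0] by simp
  show "?h x \<le> 1" for x
    using pos[of x] flat_exp_nonneg[of 0 "b - x"] by (simp add: field_simps)
  show "?h x = 0" if "x \<le> a" for x
    using that by (simp add: flat_exp_def)
  show "?h x = 1" if "b \<le> x" for x
  proof -
    have "?e (b - x) = 0" using that by (simp add: flat_exp_def)
    then show ?thesis using pos[of x] by simp
  qed
qed

lemma antiderivative_exists:
  fixes f :: "real \<Rightarrow> real"
  assumes "continuous_on UNIV f"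
  obtains G where "\<And>x. (G has_real_derivative f x) (at x)" "G a = 0"
proof -
  have "isCont f x" for x
    using assms by (simp add: continuous_on_eq_continuous_at)
  then obtain G where G: "\<And>x. (G has_vector_derivative f x) (at x)"
    using einterval_antiderivative[of "-\<infinity>" "\<infinity>" f] by auto
  show ?thesis
  proof
    show "((\<lambda>x. G x - G a) has_real_derivative f x) (at x)" for x
      using G[of x] by (auto intro!: derivative_eq_intros simp: has_real_derivative_iff_has_vector_derivative)
  qed simp
qed

lemma Ck_on_vec_nth [Ck_intros]: "open U \<Longrightarrow> Ck_on k U (\<lambda>u :: real ^ 'n. u $ i)"
  by (rule Ck_on_bounded_linear[OF bounded_linear_vec_nth])

section \<open>Graphs as surface charts\<close>

text \<open>A graph over the coordinate plane of the \<open>j\<close>-th and \<open>k\<close>-th axes is parametrized by a map \<open>X\<close>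
  with a linear left inverse, the projection \<open>P\<close> to that plane. This one map shows both that the
  inverse of \<open>X\<close> is continuous and, by differentiating \<open>P \<circ> X = id\<close>, that \<open>X\<close> is an immersion.\<close>

lemma graph_chart:
  fixes f :: "real^2 \<Rightarrow> real" and i j k :: 3
  assumes ijk: "i \<noteq> j" "i \<noteq> k" "j \<noteq> k"
    and "open U" "open V" "p \<in> V" "\<And>n. Ck_on n U f"
    and graph: "\<And>q. q \<in> S \<inter> V \<longleftrightarrow> vector [q$j, q$k] \<in> U \<and> q$i = f (vector [q$j, q$k])"
  shows "\<exists>(U :: (real^2) set) V X Y.
        open U \<and> open V \<and> p \<in> V \<and> smooth_on U X \<and> homeomorphism U (S \<inter> V) X Y \<and>
        (\<forall>u\<in>U. inj (frechet_derivative X (at u)))"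
proof (intro exI conjI ballI)
  define X :: "real^2 \<Rightarrow> real^3" where
    "X = (\<lambda>u. f u *\<^sub>R axis i 1 + u$1 *\<^sub>R axis j 1 + u$2 *\<^sub>R axis k 1)"
  define P :: "real^3 \<Rightarrow> real^2" where "P = (\<lambda>q. vector [q$j, q$k])"
  have X_nth: "X u $ i = f u" "X u $ j = u$1" "X u $ k = u$2" for u
    using ijk by (auto simp: X_def axis_def)
  have left_inv: "P (X u) = u" for u
    by (simp add: P_def X_nth vec_eq_iff forall_2)
  have Ck_X: "Ck_on n U X" for n
    unfolding X_def by (intro Ck_intros assms)
  have "linear P"
    unfolding P_def by (rule linearI) (simp_all add: vec_eq_iff forall_2)
  then have bl: "bounded_linear P"
    by (simp add: linear_conv_bounded_linear)
  have graph': "q \<in> S \<inter> V \<longleftrightarrow> P q \<in> U \<and> q$i = f (P q)" for q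
    using graph unfolding P_def .
  have right_inv: "X (P q) = q" if "q$i = f (P q)" for q
  proof -
    have "X (P q) $ l = q $ l" for l
    proof -
      have "l = i \<or> l = j \<or> l = k"
        using ijk exhaust_3[of i] exhaust_3[of j] exhaust_3[of k] exhaust_3[of l] by metis
      then show ?thesis
        using that by (auto simp: X_nth) (simp_all add: P_def)
    qed
    then show ?thesis by (simp add: vec_eq_iff)
  qed
  have image: "X ` U = S \<inter> V"
  proof (intro equalityI subsetI)
    show "q \<in> S \<inter> V" if "q \<in> X ` U" for q
      using that by (auto simp: graph' left_inv X_nth simp del: Int_iff)
    show "q \<in> X ` U" if "q \<in> S \<inter> V" for q
      using that right_inv[of q] unfolding graph' by (metis imageI)
  qed
  show "smooth_on U X" using assms(4) Ck_X by (rule smooth_onI)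
  have "continuous_on U X" using Ck_X[of 0] by simp
  moreover have "continuous_on (S \<inter> V) P"
    by (rule linear_continuous_on[OF bl])
  moreover have "P ` (S \<inter> V) = U"
    unfolding image[symmetric] image_image left_inv by simp
  ultimately show "homeomorphism U (S \<inter> V) X P"
    unfolding homeomorphism_def using image left_inv right_inv graph' by blast
  fix u assume u: "u \<in> U"
  define D where "D = frechet_derivative X (at u)"
  have "(X has_derivative D) (at u)"
    unfolding D_def by (rule Ck_on_has_derivative[OF Ck_X u])
  then have "((\<lambda>u. P (X u)) has_derivative (\<lambda>v. P (D v))) (at u)"
    by (rule bounded_linear.has_derivative[OF bl])
  then have "((\<lambda>u. u) has_derivative (\<lambda>v. P (D v))) (at u)"
    unfolding left_inv .
  then have "(\<lambda>v. P (D v)) = (\<lambda>v. v)"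
    by (rule has_derivative_unique) (rule has_derivative_ident)
  then have "P (D v) = v" for v
    by (rule fun_cong)
  then show "inj (frechet_derivative X (at u))"
    unfolding D_def by (rule inj_on_inverseI)
qed (use assms in auto)

section \<open>Bodies of revolution with a concave profile\<close>

definition revolution_body :: "(real \<Rightarrow> real) \<Rightarrow> (real^3) set" where
  "revolution_body F = {p. (p$1)\<^sup>2 + (p$2)\<^sup>2 \<le> F (p$3)}"

definition revolution_surface :: "(real \<Rightarrow> real) \<Rightarrow> (real^3) set" where
  "revolution_surface F = {p. (p$1)\<^sup>2 + (p$2)\<^sup>2 = F (p$3)}"

text \<open>The profile \<open>F\<close> prescribes the squared radius at each height. It is concave on the whole line,
  also where it is negative and no point of the body lies: this makes \<open>F z - x\<^sup>2 - y\<^sup>2\<close> concave on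
  all of space. The last assumption says that \<open>F\<close> is still positive at the height \<open>4 \<zeta>\<close> where the
  spherical part begins.\<close>

locale cap_profile =
  fixes F :: "real \<Rightarrow> real" and a \<zeta> c R :: real
  assumes smooth: "smooth_on UNIV F"
    and concave: "concave_on UNIV F"
    and a_pos: "0 < a" and \<zeta>_pos: "0 < \<zeta>"
    and linear_below: "\<And>z. z \<le> \<zeta> \<Longrightarrow> F z = a * z"
    and circular_above: "\<And>z. 4 * \<zeta> \<le> z \<Longrightarrow> F z = R\<^sup>2 - (z - c)\<^sup>2"
    and proper_cap: "\<bar>4 * \<zeta> - c\<bar> < R"
begin

text \<open>The height of the top point of the body, which is the north pole of the sphere.\<close>

abbreviation height :: real where "height \<equiv> c + R"

lemma F_0: "F 0 = 0"
  using linear_below[of 0] \<zeta>_pos by simp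

lemma F_height: "F height = 0"
  using circular_above[of height] proper_cap by (simp add: abs_less_iff)

lemma R_pos: "0 < R" and height_gt: "4 * \<zeta> < height"
  using proper_cap by (auto simp: abs_less_iff)

lemma concaveD:
  "0 \<le> t \<Longrightarrow> t \<le> 1 \<Longrightarrow> (1 - t) * F x + t * F y \<le> F ((1 - t) * x + t * y)"
  using concave_onD[OF concave] by simp

lemma continuous_F: "continuous_on UNIV F"
  using smooth_on_UNIV_D[OF smooth, of 0] by simp

lemma continuous_on_F [continuous_intros]: "continuous_on A f \<Longrightarrow> continuous_on A (\<lambda>x. F (f x))"
  using continuous_on_compose2[OF continuous_F] by blast

lemma Ck_F: "open U \<Longrightarrow> Ck_on k U f \<Longrightarrow> Ck_on k U (\<lambda>x. F (f x))"
  by (rule Ck_on_compose_UNIV[OF _ smooth_on_UNIV_D[OF smooth]])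

lemma circular_pos: "4 * \<zeta> \<le> z \<Longrightarrow> z < height \<Longrightarrow> 0 < R\<^sup>2 - (z - c)\<^sup>2"
  using power_strict_mono[of "\<bar>z - c\<bar>" R 2] proper_cap by (simp add: abs_less_iff)

lemma F_pos: assumes "0 < z" "z < height" shows "0 < F z"
proof -
  consider "z \<le> \<zeta>" | "\<zeta> < z" "z < 4 * \<zeta>" | "4 * \<zeta> \<le> z" by linarith
  then show ?thesis
  proof cases
    case 2
    \<comment> \<open>In the transition zone only concavity is known, and \<open>F\<close> is positive at both ends.\<close>
    have ends: "0 < F \<zeta>" "0 < F (4 * \<zeta>)"
      using linear_below[of \<zeta>] circular_above[of "4 * \<zeta>"] circular_pos[of "4 * \<zeta>"] a_pos \<zeta>_pos height_gt
      by auto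
    define t where "t = (z - \<zeta>) / (3 * \<zeta>)"
    have t: "0 < t" "t < 1" "z = (1 - t) * \<zeta> + t * (4 * \<zeta>)"
      using 2 \<zeta>_pos by (auto simp: t_def field_simps)
    have "0 < (1 - t) * F \<zeta> + t * F (4 * \<zeta>)"
      using t ends by (intro add_pos_pos mult_pos_pos) auto
    also have "\<dots> \<le> F z"
      using concaveD[of t \<zeta> "4 * \<zeta>"] t by simp
    finally show ?thesis .
  qed (use assms linear_below circular_above circular_pos a_pos in auto)
qed

lemma F_neg_above: assumes "height < z" shows "F z < 0"
proof -
  have "R\<^sup>2 < (z - c)\<^sup>2"
    using assms R_pos by (intro power_strict_mono) auto
  then show ?thesis
    using circular_above[of z] height_gt assms by simp
qed

lemma F_nonneg_iff: "0 \<le> F z \<longleftrightarrow> 0 \<le> z \<and> z \<le> height"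
proof -
  have "F z < 0" if "z < 0"
    using linear_below[of z] a_pos \<zeta>_pos that by (simp add: mult_pos_neg)
  moreover have "0 \<le> F z" if "0 \<le> z" "z \<le> height"
    using F_pos[of z] F_0 F_height that by (cases "z = 0 \<or> z = height") auto
  ultimately show ?thesis
    using F_neg_above[of z] by force
qed

lemma F_zero_iff: "F z = 0 \<longleftrightarrow> z = 0 \<or> z = height"
  using F_nonneg_iff[of z] F_pos[of z] F_0 F_height by force

lemma F_le_linear: "F z \<le> a * z"
proof (cases "z \<le> \<zeta>")
  case False
  define t where "t = \<zeta> / z"
  have t: "0 < t" "t < 1" "t * z = \<zeta>" using False \<zeta>_pos by (auto simp: t_def)
  then have "t * F z \<le> F \<zeta>"
    using concaveD[of t 0 z] F_0 by simp
  also have "\<dots> = t * (a * z)"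
    using linear_below[of \<zeta>] t by (simp add: mult.left_commute)
  finally show ?thesis using t by simp
qed (simp add: linear_below)

abbreviation "B \<equiv> revolution_body F"
abbreviation "S \<equiv> revolution_surface F"

lemma body_height: "p \<in> B \<Longrightarrow> 0 \<le> p$3 \<and> p$3 \<le> height"
  using F_nonneg_iff[of "p$3"] by (simp add: revolution_body_def)
    (meson order_trans sum_power2_ge_zero)

lemma body_radius: "p \<in> B \<Longrightarrow> (p$1)\<^sup>2 + (p$2)\<^sup>2 \<le> a * height"
  using body_height[of p] F_le_linear[of "p$3"] a_pos
  by (simp add: revolution_body_def) (meson mult_left_mono less_imp_le order_trans)

lemma convex_body_B: "convex_body B"
proof -
  have "closed B"
    unfolding revolution_body_def by (intro closed_Collect_le continuous_intros)
  moreover have "bounded B"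
  proof (rule boundedI)
    fix p assume "p \<in> B"
    note p = body_height[OF this] body_radius[OF this]
    have "(p$3)\<^sup>2 \<le> height\<^sup>2" using p by (intro power_mono) auto
    moreover have "(norm p)\<^sup>2 = (p$1)\<^sup>2 + (p$2)\<^sup>2 + (p$3)\<^sup>2"
      unfolding norm_vec_def L2_set_def by (simp add: sum_3 real_sqrt_pow2)
    ultimately have "(norm p)\<^sup>2 \<le> a * height + height\<^sup>2"
      using p by linarith
    then show "norm p \<le> sqrt (a * height + height\<^sup>2)"
      by (rule real_le_rsqrt)
  qed
  moreover have "convex B"
  proof (rule convexI)
    fix p q :: "real^3" and u v :: real
    assume pq: "p \<in> B" "q \<in> B" and uv: "0 \<le> u" "0 \<le> v" "u + v = 1"
    have v: "v = 1 - u" using uv(3) by simp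
    have sq: "(u * x + v * y)\<^sup>2 \<le> u * x\<^sup>2 + v * y\<^sup>2" for x y :: real
    proof -
      have "u * x\<^sup>2 + v * y\<^sup>2 - (u * x + v * y)\<^sup>2 = u * v * (x - y)\<^sup>2"
        unfolding v by (simp add: power2_eq_square algebra_simps)
      moreover have "0 \<le> u * v * (x - y)\<^sup>2" using uv by simp
      ultimately show ?thesis by linarith
    qed
    have "(u * p$1 + v * q$1)\<^sup>2 + (u * p$2 + v * q$2)\<^sup>2 \<le>
        u * ((p$1)\<^sup>2 + (p$2)\<^sup>2) + v * ((q$1)\<^sup>2 + (q$2)\<^sup>2)"
      using sq[of "p$1" "q$1"] sq[of "p$2" "q$2"] by (simp add: algebra_simps)
    also have "\<dots> \<le> u * F (p$3) + v * F (q$3)"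
      using pq uv by (intro add_mono mult_left_mono) (auto simp: revolution_body_def)
    also have "\<dots> \<le> F (u * p$3 + v * q$3)"
      using concaveD[of v "p$3" "q$3"] uv by (simp add: v)
    finally show "u *\<^sub>R p + v *\<^sub>R q \<in> B"
      by (simp add: revolution_body_def)
  qed
  moreover have "interior B \<noteq> {}"
  proof -
    have "open {p::real^3. (p$1)\<^sup>2 + (p$2)\<^sup>2 < F (p$3)}"
      by (intro open_Collect_less continuous_intros)
    moreover have "{p::real^3. (p$1)\<^sup>2 + (p$2)\<^sup>2 < F (p$3)} \<subseteq> B"
      by (auto simp: revolution_body_def)
    moreover have "vector [0, 0, \<zeta>] \<in> {p::real^3. (p$1)\<^sup>2 + (p$2)\<^sup>2 < F (p$3)}"
      using F_pos[of \<zeta>] \<zeta>_pos height_gt by simp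
    ultimately show ?thesis
      using interior_maximal by blast
  qed
  ultimately show ?thesis
    by (simp add: convex_body_def compact_eq_bounded_closed)
qed

lemma interior_B: "interior B = {p. (p$1)\<^sup>2 + (p$2)\<^sup>2 < F (p$3)}"
proof (rule interior_unique)
  show "{p. (p$1)\<^sup>2 + (p$2)\<^sup>2 < F (p$3)} \<subseteq> B"
    by (auto simp: revolution_body_def)
  show "open {p::real^3. (p$1)\<^sup>2 + (p$2)\<^sup>2 < F (p$3)}"
    by (intro open_Collect_less continuous_intros)
  fix T assume T: "T \<subseteq> B" "open T"
  show "T \<subseteq> {p. (p$1)\<^sup>2 + (p$2)\<^sup>2 < F (p$3)}"
  proof
    fix p assume p: "p \<in> T"
    with T(2) obtain e where e: "0 < e" "ball p e \<subseteq> T"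
      by (meson open_contains_ball)
    \<comment> \<open>Moving away from the axis at constant height stays in \<open>T\<close> and strictly increases the radius.\<close>
    define \<sigma> :: real where "\<sigma> = (if 0 \<le> p$1 then 1 else - 1)"
    define q where "q = p + (\<sigma> * e / 2) *\<^sub>R axis 1 1"
    have "q \<in> ball p e"
      using e by (simp add: q_def dist_norm \<sigma>_def)
    then have "q \<in> B" using e T by blast
    moreover have "q$1 = p$1 + \<sigma> * e / 2" "q$2 = p$2" "q$3 = p$3"
      by (auto simp: q_def axis_def)
    moreover have "(p$1)\<^sup>2 < (p$1 + \<sigma> * e / 2)\<^sup>2"
    proof -
      have "(p$1 + \<sigma> * e / 2)\<^sup>2 = (p$1)\<^sup>2 + e * (\<sigma> * p$1) + \<sigma>\<^sup>2 * (e / 2)\<^sup>2"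
        by (simp add: power2_eq_square algebra_simps)
      moreover have "0 \<le> e * (\<sigma> * p$1)" "\<sigma>\<^sup>2 = 1"
        using e by (auto simp: \<sigma>_def)
      ultimately show ?thesis using e by (simp add: add_nonneg_pos)
    qed
    ultimately show "p \<in> {p. (p$1)\<^sup>2 + (p$2)\<^sup>2 < F (p$3)}"
      by (simp add: revolution_body_def)
  qed
qed

lemma compact_B: "compact B" and closed_B: "closed B"
  using convex_body_B by (simp_all add: convex_body_def compact_imp_closed)

lemma frontier_B: "frontier B = S"
  unfolding frontier_def interior_B closure_closed[OF closed_B]
  by (auto simp: revolution_body_def revolution_surface_def)

text \<open>Off the axis one of the first two coordinates is nonzero, and with its sign \<open>\<sigma>\<close> it is
  \<open>\<sigma> sqrt (F z - y\<^sup>2)\<close>, where \<open>y\<close> is the other one. On the axis there are only the origin and the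
  top, where the equation is solved for \<open>z\<close> with the explicit formulas for \<open>F\<close>.\<close>

lemma smooth_surface_S: "smooth_surface S"
  unfolding smooth_surface_def
proof
  fix p assume p: "p \<in> S"
  let ?chart = "\<exists>(U :: (real^2) set) V X Y.
        open U \<and> open V \<and> p \<in> V \<and> smooth_on U X \<and> homeomorphism U (S \<inter> V) X Y \<and>
        (\<forall>u\<in>U. inj (frechet_derivative X (at u)))"
  have lateral: ?chart
    if ij: "i \<noteq> j" "i \<noteq> 3" "j \<noteq> 3" and S: "\<And>q. q \<in> S \<longleftrightarrow> (q$i)\<^sup>2 + (q$j)\<^sup>2 = F (q$3)"
      and pi: "p$i \<noteq> 0" for i j
  proof -
    define \<sigma> where "\<sigma> = sgn (p$i)"
    have \<sigma>: "\<sigma> * \<sigma> = 1" "0 < \<sigma> * p$i"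
      using pi by (auto simp: \<sigma>_def sgn_if)
    let ?U = "{u::real^2. 0 < F (u$2) - (u$1)\<^sup>2}" and ?V = "{q::real^3. 0 < \<sigma> * q$i}"
    show ?thesis
    proof (rule graph_chart[where U = ?U and V = ?V])
      show "open ?U" by (intro open_Collect_less continuous_intros)
      then show "Ck_on n ?U (\<lambda>u. \<sigma> * sqrt (F (u$2) - (u$1)\<^sup>2))" for n
        by (intro Ck_intros Ck_F) auto
      show "open ?V" by (intro open_Collect_less continuous_intros)
      fix q :: "real^3"
      have "x\<^sup>2 + y\<^sup>2 = w \<and> 0 < \<sigma> * x \<longleftrightarrow> 0 < w - y\<^sup>2 \<and> x = \<sigma> * sqrt (w - y\<^sup>2)" for x y w
      proof (safe)
        assume "0 < \<sigma> * x"
        then show "0 < x\<^sup>2 + y\<^sup>2 - y\<^sup>2" by auto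
        have "x\<^sup>2 = (\<sigma> * x)\<^sup>2" using \<sigma>(1) by (simp add: power2_eq_square mult.left_commute)
        then have "sqrt (x\<^sup>2 + y\<^sup>2 - y\<^sup>2) = \<sigma> * x"
          using \<open>0 < \<sigma> * x\<close> by simp
        then show "x = \<sigma> * sqrt (x\<^sup>2 + y\<^sup>2 - y\<^sup>2)"
          using \<sigma>(1) by (simp flip: mult.assoc)
      next
        assume w: "0 < w - y\<^sup>2"
        then show "(\<sigma> * sqrt (w - y\<^sup>2))\<^sup>2 + y\<^sup>2 = w"
          using \<sigma>(1) by (simp add: power_mult_distrib power2_eq_square[of \<sigma>])
        show "0 < \<sigma> * (\<sigma> * sqrt (w - y\<^sup>2))"
          using w \<sigma>(1) by (simp flip: mult.assoc)
      qed
      then show "q \<in> S \<inter> ?V \<longleftrightarrow> vector [q$j, q$3] \<in> ?U \<and>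
          q$i = \<sigma> * sqrt (F ((vector [q$j, q$3] :: real^2)$2) - ((vector [q$j, q$3] :: real^2)$1)\<^sup>2)"
        by (simp add: S)
    qed (use ij \<sigma> in auto)
  qed
  consider "p$1 \<noteq> 0" | "p$2 \<noteq> 0" | "p$1 = 0" "p$2 = 0" by blast
  then show ?chart
  proof cases
    case 1
    then show ?thesis
      by (intro lateral[of 1 2]) (auto simp: revolution_surface_def)
  next
    case 2
    then show ?thesis
      by (intro lateral[of 2 1]) (auto simp: revolution_surface_def add.commute)
  next
    case 3
    then have "p$3 = 0 \<or> p$3 = height"
      using p F_zero_iff[of "p$3"] by (simp add: revolution_surface_def)
    then show ?thesis
    proof
      assume p3: "p$3 = 0"
      let ?U = "{u::real^2. (u$1)\<^sup>2 + (u$2)\<^sup>2 < a * \<zeta>}" and ?V = "{q::real^3. q$3 < \<zeta>}"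
      let ?f = "\<lambda>u::real^2. ((u$1)\<^sup>2 + (u$2)\<^sup>2) * inverse a"
      show ?thesis
      proof (rule graph_chart[where U = ?U and V = ?V])
        show "open ?U" by (intro open_Collect_less continuous_intros)
        then show "Ck_on n ?U ?f" for n
          by (intro Ck_intros) (auto simp: a_pos)
        show "open ?V" by (intro open_Collect_less continuous_intros)
        fix q :: "real^3"
        have "w = F z \<and> z < \<zeta> \<longleftrightarrow> w < a * \<zeta> \<and> z = w * inverse a" for w z
          using linear_below[of z] a_pos by (auto simp: field_simps)
        then show "q \<in> S \<inter> ?V \<longleftrightarrow> vector [q$1, q$2] \<in> ?U \<and> q$3 = ?f (vector [q$1, q$2])"
          by (simp add: revolution_surface_def)
      qed (use p3 \<zeta>_pos in auto)
    next
      assume p3: "p$3 = height"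
      \<comment> \<open>Above height \<open>m\<close> the surface is spherical and stays in the upper hemisphere, which
        selects the positive root.\<close>
      define m where "m = max c (4 * \<zeta>)"
      have m: "c \<le> m" "4 * \<zeta> \<le> m" "m < height"
        using height_gt R_pos by (auto simp: m_def)
      let ?U = "{u::real^2. (m - c)\<^sup>2 < R\<^sup>2 - ((u$1)\<^sup>2 + (u$2)\<^sup>2)}" and ?V = "{q::real^3. m < q$3}"
      let ?f = "\<lambda>u::real^2. c + sqrt (R\<^sup>2 - ((u$1)\<^sup>2 + (u$2)\<^sup>2))"
      show ?thesis
      proof (rule graph_chart[where U = ?U and V = ?V])
        show "open ?U" by (intro open_Collect_less continuous_intros)
        then show "Ck_on n ?U ?f" for n
          by (intro Ck_intros) (auto dest: le_less_trans[OF zero_le_power2])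
        show "open ?V" by (intro open_Collect_less continuous_intros)
        fix q :: "real^3"
        have "w = F z \<and> m < z \<longleftrightarrow> (m - c)\<^sup>2 < R\<^sup>2 - w \<and> z = c + sqrt (R\<^sup>2 - w)" for w z
        proof (intro iffI conjI; elim conjE)
          assume "w = F z" "m < z"
          then have "R\<^sup>2 - w = (z - c)\<^sup>2"
            using m circular_above[of z] by simp
          moreover have "(m - c)\<^sup>2 < (z - c)\<^sup>2"
            using \<open>m < z\<close> m by (intro power_strict_mono) auto
          ultimately show "(m - c)\<^sup>2 < R\<^sup>2 - w" "z = c + sqrt (R\<^sup>2 - w)"
            using \<open>m < z\<close> m by simp_all
        next
          assume w: "(m - c)\<^sup>2 < R\<^sup>2 - w" and z: "z = c + sqrt (R\<^sup>2 - w)"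
          show "m < z"
            using real_less_rsqrt[OF w] z by simp
          moreover have "0 \<le> R\<^sup>2 - w"
            using w zero_le_power2[of "m - c"] by linarith
          ultimately show "w = F z"
            using circular_above[of z] m z by simp
        qed
        then show "q \<in> S \<inter> ?V \<longleftrightarrow> vector [q$1, q$2] \<in> ?U \<and> q$3 = ?f (vector [q$1, q$2])"
          by (simp add: revolution_surface_def)
      qed (use p3 m in auto)
    qed
  qed
qed

lemma smooth_convex_body_B: "smooth_convex_body B"
  by (simp add: smooth_convex_body_def convex_body_B frontier_B smooth_surface_S)

lemma smooth_convex_surface_S: "smooth_convex_surface S"
  unfolding smooth_convex_surface_def using convex_body_B frontier_B smooth_surface_S by blast

end

section \<open>Tangent plane, paraboloid and spherical cap\<close>

context cap_profile
begin

lemma zero_in_S: "0 \<in> S"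
  by (simp add: revolution_surface_def F_0)

lemma S_subset_B: "S \<subseteq> B"
  by (auto simp: revolution_body_def revolution_surface_def)

lemma S_Int_interior: "S \<inter> interior B = {}"
  by (auto simp: interior_B revolution_surface_def)

text \<open>The third coordinate of a curve on the surface has a minimum at the origin, so every velocity
  there is horizontal. Conversely a horizontal vector is the velocity of the parabola above its
  line in the paraboloidal part.\<close>

lemma tangent_plane_S: "tangent_plane S 0 = halfspace_boundary"
proof (intro equalityI subsetI)
  fix v assume "v \<in> tangent_plane S 0"
  then obtain \<gamma> e where e: "0 < e" "\<gamma> ` {-e<..<e} \<subseteq> S" "\<gamma> 0 = 0"
      and deriv: "(\<gamma> has_vector_derivative v) (at (0::real))"
    by (auto simp: tangent_plane_def)
  have "((\<lambda>t. \<gamma> t $ 3) has_vector_derivative v $ 3) (at 0)"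
    using bounded_linear.has_vector_derivative[OF bounded_linear_vec_nth deriv] .
  then have "((\<lambda>t. \<gamma> t $ 3) has_real_derivative v $ 3) (at 0)"
    by (simp add: has_real_derivative_iff_has_vector_derivative)
  moreover have "\<gamma> 0 $ 3 \<le> \<gamma> t $ 3" if "\<bar>0 - t\<bar> < e" for t
  proof -
    have "\<gamma> t \<in> B" using e(2) that S_subset_B by (auto simp: image_subset_iff abs_less_iff)
    then show ?thesis using body_height e(3) by simp
  qed
  ultimately have "v $ 3 = 0"
    using e(1) by (blast intro: DERIV_local_min)
  then show "v \<in> halfspace_boundary"
    by (simp add: halfspace_boundary_def)
next
  fix v assume "v \<in> halfspace_boundary"
  then have v3: "v $ 3 = 0" by (simp add: halfspace_boundary_def)
  define w where "w = (v$1)\<^sup>2 + (v$2)\<^sup>2"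
  define \<gamma> :: "real \<Rightarrow> real^3" where "\<gamma> = (\<lambda>t. t *\<^sub>R v + (t\<^sup>2 * (w / a)) *\<^sub>R axis 3 1)"
  \<comment> \<open>Keeps the parabola below height \<open>\<zeta>\<close>; the summand \<open>1\<close> covers the case \<open>v = 0\<close>.\<close>
  define e where "e = sqrt (a * \<zeta> / (w + 1))"
  have w: "0 \<le> w" by (simp add: w_def)
  then have e: "0 < e" using a_pos \<zeta>_pos by (simp add: e_def)
  have "smooth_on {-e<..<e} \<gamma>"
    unfolding \<gamma>_def by (intro smooth_onI Ck_intros Ck_on_id) auto
  moreover have "\<gamma> t \<in> S" if t: "t \<in> {-e<..<e}" for t
  proof -
    have "t\<^sup>2 < e\<^sup>2"
      using t power_strict_mono[of "\<bar>t\<bar>" e 2] by (simp add: abs_less_iff)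
    then have "t\<^sup>2 < a * \<zeta> / (w + 1)"
      using w a_pos \<zeta>_pos by (simp add: e_def)
    then have "t\<^sup>2 * w \<le> a * \<zeta>"
      using w by (simp add: pos_less_divide_eq algebra_simps) (smt (verit) zero_le_power2)
    then have "t\<^sup>2 * (w / a) \<le> \<zeta>"
      using a_pos by (simp add: field_simps)
    from linear_below[OF this] have F: "F (t\<^sup>2 * (w / a)) = t\<^sup>2 * w"
      using a_pos by simp
    have \<gamma>: "\<gamma> t $ 1 = t * v$1" "\<gamma> t $ 2 = t * v$2" "\<gamma> t $ 3 = t\<^sup>2 * (w / a)"
      using v3 by (auto simp: \<gamma>_def axis_def)
    have "(t * v$1)\<^sup>2 + (t * v$2)\<^sup>2 = t\<^sup>2 * w"
      by (simp add: w_def power_mult_distrib distrib_left)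
    then show ?thesis
      unfolding revolution_surface_def mem_Collect_eq \<gamma> F .
  qed
  moreover have "(\<gamma> has_vector_derivative v) (at 0)"
    unfolding \<gamma>_def using a_pos by (auto intro!: derivative_eq_intros)
  moreover have "\<gamma> 0 = 0" by (simp add: \<gamma>_def)
  ultimately show "v \<in> tangent_plane S 0"
    unfolding tangent_plane_def using e by (auto intro!: exI[of _ \<gamma>] exI[of _ e])
qed

lemma paraboloid_below: "\<exists>P. paraboloid P \<and> S \<inter> slab 0 \<zeta> = P \<inter> slab 0 \<zeta>"
proof (intro exI conjI)
  let ?P = "{q :: real^3. q$3 = inverse a * (q$1)\<^sup>2 + inverse a * (q$2)\<^sup>2}"
  have "orthogonal_transformation (\<lambda>q :: real^3. q)"
    by (simp add: orthogonal_transformation_def linear_ident)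
  then show "paraboloid ?P"
    unfolding paraboloid_def using a_pos
    by (intro exI[of _ "inverse a"] exI[of _ 0] exI[of _ "\<lambda>q. q"]) auto
  show "S \<inter> slab 0 \<zeta> = ?P \<inter> slab 0 \<zeta>"
    using a_pos linear_below
    by (auto simp: revolution_surface_def slab_def field_simps)
qed

lemma spherical_cap_above:
  assumes "height \<le> h"
  shows "spherical_cap (S \<inter> slab (4 * \<zeta>) h)"
  unfolding spherical_cap_def
proof (intro exI conjI)
  let ?n = "axis 3 1 :: real^3"
  show "norm ?n = 1" by simp
  show "0 < R" by (rule R_pos)
  show "\<bar>4 * \<zeta> - ?n \<bullet> (c *\<^sub>R ?n)\<bar> < R"
    using proper_cap by (simp add: inner_axis_axis)
  have "q \<in> sphere (c *\<^sub>R ?n) R \<longleftrightarrow> (q$1)\<^sup>2 + (q$2)\<^sup>2 = R\<^sup>2 - (q$3 - c)\<^sup>2" for q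
  proof -
    have "(dist (c *\<^sub>R ?n) q)\<^sup>2 = (q$1)\<^sup>2 + (q$2)\<^sup>2 + (q$3 - c)\<^sup>2"
      unfolding dist_vec_def L2_set_def
      by (simp add: sum_3 real_sqrt_pow2 axis_def dist_real_def power2_commute)
    moreover have "dist (c *\<^sub>R ?n) q = R \<longleftrightarrow> (dist (c *\<^sub>R ?n) q)\<^sup>2 = R\<^sup>2"
      using R_pos by (simp add: power2_eq_iff_nonneg)
    ultimately show ?thesis by auto
  qed
  moreover have "?n \<bullet> q = q$3" for q
    by (simp add: inner_axis_axis cart_eq_inner_axis inner_commute)
  moreover have "q$3 \<le> h" if "q \<in> S" for q
    using body_height[of q] S_subset_B that assms by auto
  ultimately show "S \<inter> slab (4 * \<zeta>) h = sphere (c *\<^sub>R ?n) R \<inter> {q. 4 * \<zeta> \<le> ?n \<bullet> q}"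
    using circular_above by (auto simp: slab_def revolution_surface_def)
qed

section \<open>Homothetic copies\<close>

text \<open>Strict star-shapedness about the boundary point \<open>0\<close>. Concavity with \<open>F 0 = 0\<close> makes \<open>F\<close> shrink
  at most by the factor \<open>\<kappa>\<close>, while the squared radius shrinks by \<open>\<kappa>\<^sup>2\<close>. On the axis, where this
  comparison is not strict, \<open>F\<close> is positive strictly between the bottom and the top. Both the
  disjointness of the leaves and the description of the region between two of them rest on this.\<close>

lemma scaled_body_in_interior:
  assumes q: "q \<in> B" "q \<noteq> 0" and \<kappa>: "0 < \<kappa>" "\<kappa> < 1"
  shows "\<kappa> *\<^sub>R q \<in> interior B"
proof -
  let ?w = "(q$1)\<^sup>2 + (q$2)\<^sup>2"
  have w: "0 \<le> ?w" "?w \<le> F (q$3)" using q by (auto simp: revolution_body_def)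
  have "\<kappa>\<^sup>2 * ?w < F (\<kappa> * q$3)"
  proof (cases "?w = 0")
    case True
    then have "q$1 = 0" "q$2 = 0" by (auto simp: sum_power2_eq_zero_iff)
    with q(2) have "q$3 \<noteq> 0" by (auto simp: vec_eq_iff forall_3)
    with body_height[OF q(1)] have "0 < q$3" "q$3 \<le> height" by auto
    have "\<kappa> * q$3 < 1 * q$3"
      using \<kappa>(2) \<open>0 < q$3\<close> by (rule mult_strict_right_mono)
    then have "0 < \<kappa> * q$3" "\<kappa> * q$3 < height"
      using \<kappa>(1) \<open>0 < q$3\<close> \<open>q$3 \<le> height\<close> by (simp, linarith)
    with True F_pos show ?thesis by simp
  next
    case False
    have "0 < \<kappa> * ?w"
      using False w \<kappa> by (intro mult_pos_pos) linarith+
    with \<kappa>(2) have "\<kappa> * (\<kappa> * ?w) < 1 * (\<kappa> * ?w)"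
      by (rule mult_strict_right_mono)
    then have "\<kappa>\<^sup>2 * ?w < \<kappa> * ?w"
      by (simp only: power2_eq_square mult.assoc mult_1)
    also have "\<dots> \<le> \<kappa> * F (q$3)"
      using w \<kappa> by (intro mult_left_mono) auto
    also have "\<dots> \<le> F (\<kappa> * q$3)"
      using concaveD[of \<kappa> 0 "q$3"] \<kappa> F_0 by simp
    finally show ?thesis .
  qed
  then show ?thesis
    by (simp add: interior_B power_mult_distrib distrib_left)
qed

lemma ray_meets_S:
  assumes "m *\<^sub>R p \<in> B" "n *\<^sub>R p \<notin> interior B" "m \<le> n"
  obtains \<mu> where "m \<le> \<mu>" "\<mu> \<le> n" "\<mu> *\<^sub>R p \<in> S"
proof (cases "n *\<^sub>R p \<in> B")
  case True
  with assms that closed_B show ?thesis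
    by (metis Diff_iff closure_closed frontier_B frontier_def order_refl)
next
  case False
  have "connected ((\<lambda>\<mu>. \<mu> *\<^sub>R p) ` {m..n})"
    by (intro connected_continuous_image continuous_intros) auto
  then have "(\<lambda>\<mu>. \<mu> *\<^sub>R p) ` {m..n} \<inter> frontier B \<noteq> {}"
    by (rule connected_Int_frontier) (use assms False in force)+
  with that show ?thesis by (auto simp: frontier_B)
qed

end

text \<open>The profile of the body scaled by \<open>l\<close>, see \<open>mem_scaled_surface\<close>. Through it, all that is known
  about surfaces with a profile applies to the scaled copies as well.\<close>

definition scaled_profile :: "real \<Rightarrow> (real \<Rightarrow> real) \<Rightarrow> real \<Rightarrow> real" where
  "scaled_profile l F = (\<lambda>z. l\<^sup>2 * F (inverse l * z))"

lemma mem_scaled_surface: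
  assumes "0 < l"
  shows "p \<in> revolution_surface (scaled_profile l F) \<longleftrightarrow> inverse l *\<^sub>R p \<in> revolution_surface F"
  using assms
  by (simp add: revolution_surface_def scaled_profile_def power_mult_distrib field_simps)

context cap_profile
begin

lemma cap_profile_scaled:
  assumes l: "0 < l"
  shows "cap_profile (scaled_profile l F) (l * a) (l * \<zeta>) (l * c) (l * R)"
proof
  have "Ck_on k UNIV (scaled_profile l F)" for k
    unfolding scaled_profile_def by (intro Ck_intros Ck_F Ck_on_id open_UNIV)
  then show "smooth_on UNIV (scaled_profile l F)"
    by (intro smooth_onI) auto
  show "concave_on UNIV (scaled_profile l F)"
    unfolding concave_on_iff
  proof (intro conjI ballI allI impI)
    fix x y u v :: real
    assume uv: "0 \<le> u" "0 \<le> v" "u + v = 1"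
    let ?x = "inverse l * x" and ?y = "inverse l * y"
    have "u * F ?x + v * F ?y \<le> F (u * ?x + v * ?y)"
      using concave uv unfolding concave_on_iff by simp
    then have "l\<^sup>2 * (u * F ?x + v * F ?y) \<le> l\<^sup>2 * F (u * ?x + v * ?y)"
      by (rule mult_left_mono) simp
    then show "u * scaled_profile l F x + v * scaled_profile l F y
        \<le> scaled_profile l F (u *\<^sub>R x + v *\<^sub>R y)"
      by (simp add: scaled_profile_def algebra_simps)
  qed auto
  show "scaled_profile l F z = l * a * z" if "z \<le> l * \<zeta>" for z
  proof -
    have "inverse l * z \<le> \<zeta>" using that l by (simp add: field_simps)
    from linear_below[OF this] l show ?thesis
      by (simp add: scaled_profile_def power2_eq_square)
  qed
  show "scaled_profile l F z = (l * R)\<^sup>2 - (z - l * c)\<^sup>2" if "4 * (l * \<zeta>) \<le> z" for z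
  proof -
    have "4 * \<zeta> \<le> inverse l * z" using that l by (simp add: field_simps)
    moreover have "z - l * c = l * (inverse l * z - c)"
      using l by (simp add: right_diff_distrib flip: mult.assoc)
    then have "(z - l * c)\<^sup>2 = l\<^sup>2 * (inverse l * z - c)\<^sup>2"
      by (simp only: power_mult_distrib)
    ultimately show ?thesis
      using circular_above[of "inverse l * z"]
      by (simp add: scaled_profile_def power_mult_distrib right_diff_distrib)
  qed
  have "4 * (l * \<zeta>) - l * c = l * (4 * \<zeta> - c)" by (simp add: algebra_simps)
  then show "\<bar>4 * (l * \<zeta>) - l * c\<bar> < l * R"
    using proper_cap l by (simp add: abs_mult)
qed (use l a_pos \<zeta>_pos in auto)

abbreviation leaf :: "real \<Rightarrow> (real^3) set" where
  "leaf l \<equiv> revolution_surface (scaled_profile l F)"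

lemma leaves_meet_only_at_0:
  assumes "0 < l" "l < l'"
  shows "leaf l \<inter> leaf l' = {0}"
proof -
  have "p = 0" if p: "inverse l *\<^sub>R p \<in> S" "inverse l' *\<^sub>R p \<in> S" for p
  proof (rule ccontr)
    assume "p \<noteq> 0"
    then have "(l / l') *\<^sub>R (inverse l *\<^sub>R p) \<in> interior B"
      using assms p(1) S_subset_B by (intro scaled_body_in_interior) auto
    moreover have "(l / l') *\<^sub>R (inverse l *\<^sub>R p) = inverse l' *\<^sub>R p"
      using assms by (simp add: field_simps)
    ultimately show False using p(2) S_Int_interior by auto
  qed
  then show ?thesis
    using assms zero_in_S by (auto simp: mem_scaled_surface)
qed

text \<open>A ray through a point \<open>p\<close> of the body starts at \<open>p\<close> inside and is eventually outside, so it
  crosses the surface at some \<open>\<mu> p\<close> with \<open>\<mu> \<ge> 1\<close>; then \<open>p\<close> lies on the leaf with ratio \<open>1 / \<mu>\<close>.\<close>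

lemma leaves_fill_B: "(\<Union>l\<in>{0<..1}. leaf l) = B"
proof (intro equalityI subsetI)
  fix p assume "p \<in> (\<Union>l\<in>{0<..1}. leaf l)"
  then obtain l where l: "0 < l" "l \<le> 1" and p: "inverse l *\<^sub>R p \<in> S"
    by (auto simp: mem_scaled_surface)
  then consider "p = 0" | "l = 1" | "p \<noteq> 0" "l < 1" by linarith
  then show "p \<in> B"
  proof cases
    case 3
    then have "l *\<^sub>R (inverse l *\<^sub>R p) \<in> interior B"
      using l p S_subset_B by (intro scaled_body_in_interior) auto
    then show ?thesis using l interior_subset by auto
  qed (use p zero_in_S S_subset_B in auto)
next
  fix p assume p: "p \<in> B"
  show "p \<in> (\<Union>l\<in>{0<..1}. leaf l)"
  proof (cases "p = 0")
    case True
    then show ?thesis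
      using zero_in_S by (intro UN_I[of 1]) (auto simp: mem_scaled_surface)
  next
    case False
    obtain b where b: "\<And>q. q \<in> B \<Longrightarrow> norm q \<le> b"
      using compact_imp_bounded[OF compact_B] by (auto simp: bounded_iff)
    define n where "n = b / norm p + 1"
    have n: "1 \<le> n" using b[OF p] norm_ge_zero[of p] by (simp add: n_def del: norm_ge_zero)
    have "norm (n *\<^sub>R p) = b + norm p"
      using False n by (simp add: n_def field_simps)
    then have "n *\<^sub>R p \<notin> interior B"
      using b[of "n *\<^sub>R p"] False interior_subset by fastforce
    moreover have "1 *\<^sub>R p \<in> B" using p by simp
    ultimately obtain \<mu> where "1 \<le> \<mu>" "\<mu> *\<^sub>R p \<in> S"
      using ray_meets_S n by metis
    then show ?thesis
      by (intro UN_I[of "inverse \<mu>"]) (auto simp: mem_scaled_surface field_simps)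
  qed
qed

text \<open>This identifies the swept region, up to one point, with an open set, which settles its
  measurability and the positivity of its volume.\<close>

lemma leaves_between:
  assumes l: "0 < l" "l < l'"
  shows "(\<Union>k\<in>{l<..<l'}. leaf k) =
    insert 0 {p. inverse l' *\<^sub>R p \<in> interior B \<and> inverse l *\<^sub>R p \<notin> B}" (is "?U = insert 0 ?O")
proof (intro equalityI subsetI)
  fix p assume "p \<in> ?U"
  then obtain k where k: "l < k" "k < l'" and p: "inverse k *\<^sub>R p \<in> S"
    using l by (auto simp: mem_scaled_surface)
  show "p \<in> insert 0 ?O"
  proof (cases "p = 0")
    case False
    have "(k / l') *\<^sub>R (inverse k *\<^sub>R p) \<in> interior B"
      using False l k p S_subset_B by (intro scaled_body_in_interior) auto
    moreover have "(k / l') *\<^sub>R (inverse k *\<^sub>R p) = inverse l' *\<^sub>R p"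
      using l k by (simp add: divide_inverse)
    ultimately have "inverse l' *\<^sub>R p \<in> interior B"
      by (simp only:)
    moreover have "inverse l *\<^sub>R p \<notin> B"
    proof
      assume "inverse l *\<^sub>R p \<in> B"
      then have "(l / k) *\<^sub>R (inverse l *\<^sub>R p) \<in> interior B"
        using False l k by (intro scaled_body_in_interior) auto
      moreover have "(l / k) *\<^sub>R (inverse l *\<^sub>R p) = inverse k *\<^sub>R p"
        using l k by (simp add: field_simps)
      ultimately show False using p S_Int_interior by auto
    qed
    ultimately show ?thesis by simp
  qed simp
next
  fix p assume "p \<in> insert 0 ?O"
  then consider "p = 0" | "inverse l' *\<^sub>R p \<in> interior B" "inverse l *\<^sub>R p \<notin> B" by auto
  then show "p \<in> ?U"
  proof cases
    case 1
    then show ?thesis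
      using l zero_in_S by (intro UN_I[of "(l + l') / 2"]) (auto simp: mem_scaled_surface)
  next
    case 2
    have "inverse l' \<le> inverse l" using l by simp
    with 2 obtain \<mu> where \<mu>: "inverse l' \<le> \<mu>" "\<mu> \<le> inverse l" "\<mu> *\<^sub>R p \<in> S"
      using ray_meets_S[of "inverse l'" p "inverse l"] interior_subset by (metis subsetD)
    with 2 S_Int_interior S_subset_B have "\<mu> \<noteq> inverse l'" "\<mu> \<noteq> inverse l" by auto
    with \<mu> have "inverse l' < \<mu>" "\<mu> < inverse l" by auto
    moreover from this have "0 < \<mu>" using l by (meson inverse_positive_iff_positive less_trans)
    ultimately have "inverse \<mu> \<in> {l<..<l'}"
      using l by (auto simp: field_simps)
    with \<mu>(3) \<open>0 < \<mu>\<close> show ?thesis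
      by (intro UN_I[of "inverse \<mu>"]) (auto simp: mem_scaled_surface)
  qed
qed

lemma measure_leaves_between_pos:
  assumes l: "0 < l" "l < l'"
  shows "0 < measure lebesgue (\<Union>k\<in>{l<..<l'}. leaf k)"
proof -
  let ?O = "{p. inverse l' *\<^sub>R p \<in> interior B \<and> inverse l *\<^sub>R p \<notin> B}"
  have "open ?O"
  proof -
    have "open ((\<lambda>p. inverse l' *\<^sub>R p) -` interior B \<inter> (\<lambda>p. inverse l *\<^sub>R p) -` (- B))"
      by (intro open_Int open_vimage continuous_intros open_interior open_Compl closed_B)
    then show ?thesis by (simp add: vimage_def Collect_conj_eq)
  qed
  moreover have "bounded ?O"
  proof (rule bounded_subset)
    show "bounded ((\<lambda>p. l' *\<^sub>R p) ` B)"
      by (intro bounded_scaling compact_imp_bounded compact_B)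
    show "?O \<subseteq> (\<lambda>p. l' *\<^sub>R p) ` B"
    proof
      fix p assume "p \<in> ?O"
      then have "inverse l' *\<^sub>R p \<in> B" using interior_subset by auto
      moreover have "p = l' *\<^sub>R (inverse l' *\<^sub>R p)" using l by simp
      ultimately show "p \<in> (\<lambda>p. l' *\<^sub>R p) ` B" by blast
    qed
  qed
  ultimately have O: "?O \<in> lmeasurable" by (rule lmeasurable_open[rotated])
  \<comment> \<open>The top of the leaf with the intermediate ratio \<open>t\<close> lies in the open set.\<close>
  define t where "t = (l + l') / 2"
  have t: "l < t" "t < l'" using l by (auto simp: t_def)
  have "vector [0, 0, t * height] \<in> ?O"
  proof -
    have h: "0 < height" using height_gt \<zeta>_pos by simp
    have "0 < inverse l' * t" "inverse l' * t < 1" "1 < inverse l * t"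
      using l t by (simp_all add: inverse_eq_divide)
    from mult_strict_right_mono[OF this(1) h] mult_strict_right_mono[OF this(2) h]
      mult_strict_right_mono[OF this(3) h]
    have "0 < inverse l' * (t * height)" "inverse l' * (t * height) < height"
      "height < inverse l * (t * height)"
      by (simp_all only: mult.assoc mult_zero_left mult_1)
    from F_pos[OF this(1,2)] F_neg_above[OF this(3)] show ?thesis
      unfolding interior_B by (simp add: revolution_body_def)
  qed
  with \<open>open ?O\<close> have "\<not> negligible ?O"
    using open_not_negligible by blast
  with O have "0 < measure lebesgue ?O"
    using negligible_iff_measure0[OF O] measure_nonneg[of lebesgue ?O] by (simp only: less_le) simp
  also have "\<dots> \<le> measure lebesgue ({0} \<union> ?O)"
  proof (rule measure_mono_fmeasurable)
    show "{0} \<union> ?O \<in> lmeasurable"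
      by (rule fmeasurable.Un[OF negligible_imp_measurable[OF negligible_sing] O])
    show "?O \<in> sets lebesgue" using O by (rule fmeasurableD)
  qed (rule Un_upper2)
  finally show ?thesis
    unfolding leaves_between[OF l] insert_is_Un[of 0 ?O] .
qed

lemma rotationally_symmetric_B: "rotationally_symmetric_z B"
  unfolding rotationally_symmetric_z_def
proof
  have inv: "rotation_z \<theta> (rotation_z (- \<theta>) p) = p" for \<theta> p
  proof -
    have id: "cos \<theta> * (cos \<theta> * x) + sin \<theta> * (sin \<theta> * x) = x" for x
      using sin_cos_squared_add3[of \<theta>] by (metis add.commute distrib_right mult.assoc mult_1)
    show ?thesis
      by (simp add: rotation_z_def vec_eq_iff forall_3 algebra_simps) (simp add: id)
  qed
  have "rotation_z \<theta> p \<in> B" if "p \<in> B" for \<theta> p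
  proof -
    have "(k * x - s * y)\<^sup>2 + (s * x + k * y)\<^sup>2 = (s\<^sup>2 + k\<^sup>2) * (x\<^sup>2 + y\<^sup>2)" for k s x y :: real
      by (simp add: power2_eq_square algebra_simps)
    from this[of "cos \<theta>" "p$1" "sin \<theta>" "p$2"] show ?thesis
      using that by (simp add: revolution_body_def rotation_z_def)
  qed
  then show "rotation_z \<theta> ` B = B" for \<theta>
    by (metis (no_types, lifting) image_eqI image_subsetI inv subsetI subset_antisym)
qed

end

section \<open>Existence of a profile\<close>

text \<open>With \<open>G'' = h\<close> for a smooth step \<open>h\<close> from \<open>\<zeta>\<close> to \<open>4 \<zeta>\<close>, the function \<open>G\<close> vanishes below \<open>\<zeta>\<close> and
  equals \<open>(z - m)\<^sup>2 / 2 + k\<close> above \<open>4 \<zeta>\<close>, so \<open>F = a z - 2 G\<close> has the required form after completing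
  the square. The hypothesis \<open>9 \<zeta> < 4 a\<close> keeps \<open>F\<close> positive at \<open>4 \<zeta>\<close>, because \<open>2 G\<close> is at most
  \<open>(3 \<zeta>)\<^sup>2\<close> there. Comparing \<open>2 G\<close> with \<open>(z - 4 \<zeta>)\<^sup>2\<close> bounds the height of the body.\<close>

lemma cap_profile_exists:
  fixes a \<zeta> :: real
  assumes a: "0 < a" and \<zeta>: "0 < \<zeta>" "9 * \<zeta> < 4 * a"
  obtains F c R where "cap_profile F a \<zeta> c R" "c + R \<le> a + 8 * \<zeta>"
proof -
  obtain h where Ck_h: "\<And>k. Ck_on k UNIV h" and h: "\<And>z. 0 \<le> h z" "\<And>z. h z \<le> 1"
      "\<And>z. z \<le> \<zeta> \<Longrightarrow> h z = 0" "\<And>z. 4 * \<zeta> \<le> z \<Longrightarrow> h z = (1::real)"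
    using smooth_step_exists[of \<zeta> "4 * \<zeta>"] \<zeta> by auto
  obtain H where H: "\<And>z. (H has_real_derivative h z) (at z)" "H \<zeta> = 0"
    using antiderivative_exists[of h \<zeta>] Ck_h[of 0] by auto
  have Ck_H: "Ck_on k UNIV H" for k
    by (rule Ck_on_antiderivative[OF H(1) Ck_h])
  obtain G where G: "\<And>z. (G has_real_derivative H z) (at z)" "G \<zeta> = 0"
    using antiderivative_exists[of H \<zeta>] Ck_H[of 0] by auto
  have Ck_G: "Ck_on k UNIV G" for k
    by (rule Ck_on_antiderivative[OF G(1) Ck_H])
  have const: "f x = f y" if "convex A" "\<And>z. z \<in> A \<Longrightarrow> (f has_real_derivative 0) (at z)"
      "x \<in> A" "y \<in> A" for A f x y
    using has_field_derivative_zero_constant[OF that(1), of f] that(2-)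
      has_field_derivative_at_within by metis
  have H_below: "H z = 0" if "z \<le> \<zeta>" for z
    using const[of "{..\<zeta>}" H z \<zeta>] H h(3) that by (metis atMost_iff convex_real_interval(2) order_refl)
  have G_below: "G z = 0" if "z \<le> \<zeta>" for z
    using const[of "{..\<zeta>}" G z \<zeta>] G H_below that by (metis atMost_iff convex_real_interval(2) order_refl)
  define m where "m = 4 * \<zeta> - H (4 * \<zeta>)"
  have H_above: "H z = z - m" if "4 * \<zeta> \<le> z" for z
  proof -
    have "((\<lambda>z. H z - z) has_real_derivative 0) (at z)" if "z \<in> {4 * \<zeta>..}" for z
      using h(4)[of z] that by (auto intro!: derivative_eq_intros H)
    from const[of "{4 * \<zeta>..}" "\<lambda>z. H z - z" z "4 * \<zeta>", OF _ this] that
    show ?thesis by (simp add: m_def)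
  qed
  define k where "k = G (4 * \<zeta>) - (4 * \<zeta> - m)\<^sup>2 / 2"
  have G_above: "G z = (z - m)\<^sup>2 / 2 + k" if "4 * \<zeta> \<le> z" for z
  proof -
    have "((\<lambda>z. G z - (z - m)\<^sup>2 / 2) has_real_derivative 0) (at z)" if "z \<in> {4 * \<zeta>..}" for z
      using H_above[of z] that by (auto intro!: derivative_eq_intros G)
    from const[of "{4 * \<zeta>..}" "\<lambda>z. G z - (z - m)\<^sup>2 / 2" z "4 * \<zeta>", OF _ this] that
    show ?thesis by (simp add: k_def)
  qed
  have mono: "f x \<le> f y" if "x \<le> y" "\<And>z. x \<le> z \<Longrightarrow> z \<le> y \<Longrightarrow> (f has_real_derivative f' z) (at z)"
      "\<And>z. x \<le> z \<Longrightarrow> z \<le> y \<Longrightarrow> 0 \<le> f' z" for f f' x y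
    using DERIV_nonneg_imp_nondecreasing[OF that(1), of f] that(2,3) by metis
  have H_bounds: "0 \<le> H z" "H z \<le> z - \<zeta>" if "\<zeta> \<le> z" for z
  proof -
    show "0 \<le> H z"
      using mono[OF that H(1)] h(1) H(2) by simp
    have "((\<lambda>z. z - H z) has_real_derivative 1 - h z) (at z)" for z
      by (auto intro!: derivative_eq_intros H)
    from mono[OF that this] h(2) H(2) show "H z \<le> z - \<zeta>" by simp
  qed
  have m: "m \<le> 4 * \<zeta>"
    using H_bounds[of "4 * \<zeta>"] \<zeta> by (simp add: m_def)
  have G_nonneg: "0 \<le> G (4 * \<zeta>)"
    using mono[OF _ G(1), of \<zeta> "4 * \<zeta>"] H_bounds G(2) \<zeta> by simp
  have G_le: "G (4 * \<zeta>) \<le> (3 * \<zeta>)\<^sup>2 / 2"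
  proof -
    have "((\<lambda>z. (z - \<zeta>)\<^sup>2 / 2 - G z) has_real_derivative (z - \<zeta>) - H z) (at z)" for z
      by (auto intro!: derivative_eq_intros G)
    from mono[OF _ this, of \<zeta> "4 * \<zeta>"] H_bounds G(2) \<zeta> show ?thesis by simp
  qed

  define F where "F = (\<lambda>z. a * z - 2 * G z)"
  define c where "c = m + a / 2"
  define w where "w = c\<^sup>2 - m\<^sup>2 - 2 * k"
  have F_above: "F z = w - (z - c)\<^sup>2" if "4 * \<zeta> \<le> z" for z
    by (simp add: F_def G_above[OF that] w_def c_def power2_eq_square field_simps)
  have "0 < F (4 * \<zeta>)"
  proof -
    have "9 * \<zeta> * \<zeta> < 4 * a * \<zeta>"
      using \<zeta> by (intro mult_strict_right_mono)
    then show ?thesis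
      using G_le by (simp add: F_def power2_eq_square algebra_simps)
  qed
  then have w: "(4 * \<zeta> - c)\<^sup>2 < w"
    using F_above[of "4 * \<zeta>"] by simp
  then have w0: "0 \<le> w" by (meson less_imp_le order_trans zero_le_power2)
  have "cap_profile F a \<zeta> c (sqrt w)"
  proof
    show "smooth_on UNIV F"
      unfolding F_def by (intro smooth_onI Ck_intros Ck_on_id Ck_G open_UNIV)
    show "concave_on UNIV F"
    proof (rule f''_le0_imp_concave)
      show "DERIV F z :> a - 2 * H z" for z
        unfolding F_def by (auto intro!: derivative_eq_intros G)
      show "DERIV (\<lambda>z. a - 2 * H z) z :> - 2 * h z" for z
        by (auto intro!: derivative_eq_intros H)
      show "- 2 * h z \<le> 0" for z using h(1) by simp
    qed simp
    show "F z = a * z" if "z \<le> \<zeta>" for z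
      using G_below[OF that] by (simp add: F_def)
    show "F z = (sqrt w)\<^sup>2 - (z - c)\<^sup>2" if "4 * \<zeta> \<le> z" for z
      using F_above[OF that] w0 by simp
    show "\<bar>4 * \<zeta> - c\<bar> < sqrt w"
      using real_less_rsqrt[of "\<bar>4 * \<zeta> - c\<bar>" w] w by simp
  qed (use a \<zeta> in auto)
  moreover have "c + sqrt w \<le> a + 8 * \<zeta>"
  proof -
    \<comment> \<open>At \<open>?t\<close> even the upper bound \<open>a z - (z - 4 \<zeta>)\<^sup>2\<close> of \<open>F\<close> is not positive.\<close>
    let ?t = "a + 8 * \<zeta>"
    have "F ?t \<le> 0"
    proof -
      have "(?t - 4 * \<zeta>)\<^sup>2 \<le> (?t - m)\<^sup>2 - (4 * \<zeta> - m)\<^sup>2"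
      proof -
        have "(?t - m)\<^sup>2 - (4 * \<zeta> - m)\<^sup>2 - (?t - 4 * \<zeta>)\<^sup>2 = 2 * (4 * \<zeta> - m) * (?t - 4 * \<zeta>)"
          by (simp add: power2_eq_square algebra_simps)
        moreover have "0 \<le> 2 * (4 * \<zeta> - m) * (?t - 4 * \<zeta>)"
          using m a \<zeta> by simp
        ultimately show ?thesis by linarith
      qed
      also have "\<dots> \<le> 2 * G ?t"
        using G_above[of ?t] G_nonneg a \<zeta> by (simp add: k_def field_simps)
      finally have "F ?t \<le> a * ?t - (a + 4 * \<zeta>)\<^sup>2"
        by (simp add: F_def add.commute)
      also have "\<dots> = - (16 * \<zeta>\<^sup>2)"
        by (simp add: power2_eq_square algebra_simps)
      finally show ?thesis using zero_le_power2[of \<zeta>] by linarith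
    qed
    then have "w \<le> (?t - c)\<^sup>2" using F_above[of ?t] a \<zeta> by simp
    moreover have "0 \<le> ?t - c" using m a \<zeta> by (simp add: c_def)
    ultimately have "sqrt w \<le> ?t - c" by (rule real_le_lsqrt[rotated])
    then show ?thesis by simp
  qed
  ultimately show ?thesis by (rule that)
qed

section \<open>The foliated body\<close>

theorem proposition8:
  shows "\<exists>(V\<^sub>0 :: (real^3) set) (\<Sigma> :: real \<Rightarrow> (real^3) set).
    V\<^sub>0 \<subseteq> {p. - (1/2) \<le> p$1 \<and> p$1 \<le> 1/2 \<and> - (1/2) \<le> p$2 \<and> p$2 \<le> 1/2 \<and> 0 \<le> p$3 \<and> p$3 \<le> 1} \<and>
    smooth_convex_body V\<^sub>0 \<and> rotationally_symmetric_z V\<^sub>0 \<and>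
    closure V\<^sub>0 = (\<Union>s\<in>{0..<1}. \<Sigma> s) \<and>
    (\<forall>s\<in>{0..<1}. smooth_convex_surface (\<Sigma> s)) \<and>
    (\<forall>s\<in>{0..<1}. \<forall>s'\<in>{0..<1}. s \<noteq> s' \<longrightarrow>
       \<Sigma> s \<inter> \<Sigma> s' = {0} \<and>
       tangent_plane (\<Sigma> s) 0 = tangent_plane (\<Sigma> s') 0 \<and>
       tangent_plane (\<Sigma> s') 0 = halfspace_boundary) \<and>
    (\<exists>z\<^sub>0 :: real \<Rightarrow> real.
       smooth_on {0..1} z\<^sub>0 \<and> z\<^sub>0 ` {0..1} \<subseteq> {0..1/4} \<and>
       strict_antimono_on {0..1} z\<^sub>0 \<and> (z\<^sub>0 \<longlongrightarrow> 0) (at_left 1) \<and>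
       (\<forall>s\<in>{0..<1}.
          (\<exists>P. paraboloid P \<and> \<Sigma> s \<inter> slab 0 (z\<^sub>0 s) = P \<inter> slab 0 (z\<^sub>0 s)) \<and>
          spherical_cap (\<Sigma> s \<inter> slab (4 * z\<^sub>0 s) 1))) \<and>
    (\<exists>c\<^sub>0>0. measure lebesgue (\<Union>s\<in>{1/4<..<1/2}. \<Sigma> s) \<ge> c\<^sub>0)"
proof -
  \<comment> \<open>The slope \<open>1/4\<close> bounds the squared radius by a quarter of the height, and \<open>1/32\<close> brings the
    height down to \<open>1/4 + 8/32 = 1/2\<close>.\<close>
  obtain F c R where F: "cap_profile F (1/4) (1/32) c R" and height: "c + R \<le> 1/2"
    using cap_profile_exists[of "1/4" "1/32"] by auto
  interpret cap_profile F "1/4" "1/32" c R by (rule F)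
  define \<Sigma> where "\<Sigma> = (\<lambda>s. leaf (1 - s))"
  define z\<^sub>0 :: "real \<Rightarrow> real" where "z\<^sub>0 = (\<lambda>s. (1 - s) * (1/32))"
  have scaled: "cap_profile (scaled_profile (1 - s) F) ((1 - s) * (1/4)) (z\<^sub>0 s) ((1 - s) * c) ((1 - s) * R)"
    if "s \<in> {0..<1}" for s
    unfolding z\<^sub>0_def using that by (intro cap_profile_scaled) auto
  have UN_\<Sigma>: "(\<Union>s\<in>A. \<Sigma> s) = (\<Union>l\<in>(\<lambda>s. 1 - s) ` A. leaf l)" for A
    by (simp add: \<Sigma>_def)
  show ?thesis
  proof (rule exI[of _ B], rule exI[of _ \<Sigma>],
      intro conjI ballI impI exI[of _ z\<^sub>0] exI[of _ "measure lebesgue (\<Union>s\<in>{1/4<..<1/2}. \<Sigma> s)"])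
    show "B \<subseteq> {p. - (1/2) \<le> p$1 \<and> p$1 \<le> 1/2 \<and> - (1/2) \<le> p$2 \<and> p$2 \<le> 1/2 \<and> 0 \<le> p$3 \<and> p$3 \<le> 1}"
    proof
      fix p assume p: "p \<in> B"
      have "(p$1)\<^sup>2 + (p$2)\<^sup>2 \<le> (1/2)\<^sup>2"
        using body_radius[OF p] height by (simp add: power2_eq_square)
      then have "(p$1)\<^sup>2 \<le> (1/2)\<^sup>2" "(p$2)\<^sup>2 \<le> (1/2)\<^sup>2"
        using zero_le_power2[of "p$1"] zero_le_power2[of "p$2"] by linarith+
      then have "\<bar>p$1\<bar> \<le> 1/2" "\<bar>p$2\<bar> \<le> 1/2"
        using power2_le_imp_le[of "\<bar>p$1\<bar>" "1/2"] power2_le_imp_le[of "\<bar>p$2\<bar>" "1/2"] by simp_all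
      then have "- (1/2) \<le> p$1 \<and> p$1 \<le> 1/2" "- (1/2) \<le> p$2 \<and> p$2 \<le> 1/2"
        by linarith+
      with body_height[OF p] height
      show "p \<in> {p. - (1/2) \<le> p$1 \<and> p$1 \<le> 1/2 \<and> - (1/2) \<le> p$2 \<and> p$2 \<le> 1/2 \<and> 0 \<le> p$3 \<and> p$3 \<le> 1}"
        by simp
    qed
    show "smooth_convex_body B" by (rule smooth_convex_body_B)
    show "rotationally_symmetric_z B" by (rule rotationally_symmetric_B)
    have "(\<lambda>s. 1 - s) ` {0..<1} = {0<..1::real}"
      by (auto intro!: image_eqI[of _ _ "1 - _"])
    then show "closure B = (\<Union>s\<in>{0..<1}. \<Sigma> s)"
      using leaves_fill_B closed_B by (simp add: UN_\<Sigma>)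
    have "(\<lambda>s. 1 - s) ` {1/4<..<1/2} = {1/2<..<3/4::real}"
      by (auto intro!: image_eqI[of _ _ "1 - _"])
    then show "0 < measure lebesgue (\<Union>s\<in>{1/4<..<1/2}. \<Sigma> s)"
      using measure_leaves_between_pos[of "1/2" "3/4"] by (simp add: UN_\<Sigma>)
    show "smooth_on {0..1} z\<^sub>0"
    proof -
      have "smooth_on UNIV z\<^sub>0"
        unfolding z\<^sub>0_def by (intro smooth_onI Ck_intros Ck_on_id open_UNIV)
      then show ?thesis by (rule smooth_on_subset) simp
    qed
    show "z\<^sub>0 ` {0..1} \<subseteq> {0..1/4}" by (auto simp: z\<^sub>0_def)
    show "strict_antimono_on {0..1} z\<^sub>0" by (auto simp: monotone_on_def z\<^sub>0_def)
    show "(z\<^sub>0 \<longlongrightarrow> 0) (at_left 1)"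
      unfolding z\<^sub>0_def by (auto intro!: tendsto_eq_intros)
  next
    fix s :: real assume s: "s \<in> {0..<1}"
    interpret s: cap_profile "scaled_profile (1 - s) F" "(1 - s) * (1/4)" "z\<^sub>0 s" "(1 - s) * c" "(1 - s) * R"
      by (rule scaled[OF s])
    show "smooth_convex_surface (\<Sigma> s)"
      unfolding \<Sigma>_def by (rule s.smooth_convex_surface_S)
    show "\<exists>P. paraboloid P \<and> \<Sigma> s \<inter> slab 0 (z\<^sub>0 s) = P \<inter> slab 0 (z\<^sub>0 s)"
      unfolding \<Sigma>_def by (rule s.paraboloid_below)
    have "(1 - s) * c + (1 - s) * R \<le> 1 * (1/2)"
      unfolding distrib_left[symmetric] using s height height_gt by (intro mult_mono) auto
    then show "spherical_cap (\<Sigma> s \<inter> slab (4 * z\<^sub>0 s) 1)"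
      unfolding \<Sigma>_def by (intro s.spherical_cap_above) simp
    fix s' :: real assume s': "s' \<in> {0..<1}" "s \<noteq> s'"
    interpret s': cap_profile "scaled_profile (1 - s') F" "(1 - s') * (1/4)" "z\<^sub>0 s'" "(1 - s') * c" "(1 - s') * R"
      by (rule scaled[OF s'(1)])
    show "\<Sigma> s \<inter> \<Sigma> s' = {0}"
      using leaves_meet_only_at_0[of "1 - s" "1 - s'"] leaves_meet_only_at_0[of "1 - s'" "1 - s"] s s'
      by (cases "s < s'") (auto simp: \<Sigma>_def)
    show "tangent_plane (\<Sigma> s) 0 = tangent_plane (\<Sigma> s') 0"
      and "tangent_plane (\<Sigma> s') 0 = halfspace_boundary"
      unfolding \<Sigma>_def using s.tangent_plane_S s'.tangent_plane_S by simp_all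
  qed simp
qed

end
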